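(* In Algorithm 1 (as described in the context), a strategy cannot be selected twice; consequently the algorithm terminates after a finite number of iterations (at most the number of strategies).
   Context: Setting: $f:\mathbb{R}^n\to\mathbb{R}^n$ with $f_i(x)=\min_{a\in A_i}f^a_i(x)$, $A_i$ finite, each $f^a_i:\mathbb{R}^n\to\mathbb{R}$ polyhedral (piecewise affine on finitely many polyhedra covering $\mathbb{R}^n$), order-preserving, additively homogeneous ($f^a_i(\lambda+x)=\lambda+f^a_i(x)$) and convex. A strategy is a map $\sigma$ with $\sigma(i)\in A_i$ for $i\in[n]$; $f^{(\sigma)}_i=f^{\sigma(i)}_i$. For polyhedral order-preserving additively homogeneous $g$, the cycle time $\chi(g)=\lim_k g^k(x)/k$ exists. A half-line $w:t\mapsto t\eta+v$ is considered for $t$ large (germ at infinity); it is invariant under $g$ if $g(w(t))=w(t+1)$ for all $t$ large, super-invariant if $g(w(t))\le w(t+1)$ for all $t$ large; every such $g$ has an invariant half-line, with slope $\chi(g)$. For $g$ polyhedral, convex, order-preserving, additively homogeneous with $\eta=\chi(g)$: $\hat g(\eta)=\lim_t g(t\eta)/t$, $\hat g^{\eta}(v)=\lim_t(g(t\eta+v)-t\hat g(\eta))$, $\bar g=\hat g^{\eta}-\eta$, and for a super-invariant half-line $w:t\mapsto t\eta+v$ of $g$ with $\eta=\chi(g)$, $Q_g(w)$ is the half-line $t\mapsto t\eta+\lim_k\bar g^k(v)$ (an invariant half-line of $g$). Algorithm 1: (1) $k=0$; choose a strategy $\sigma_0$ and an invariant half-line $w^{(0)}:t\mapsto t\eta^{(0)}+v^{(0)}$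 of $f^{(\sigma_0)}$. (2) If $f(w^{(k)}(t))=w^{(k)}(t+1)$ for $t$ large, stop, returning $w^{(k)}$ and $\sigma_k$. (3) Otherwise choose $\sigma_{k+1}$ with $f(w^{(k)}(t))=f^{(\sigma_{k+1})}(w^{(k)}(t))$ for $t$ large, conservatively: $\sigma_{k+1}(i)=\sigma_k(i)$ whenever $f_i(w^{(k)}(t))=f^{(\sigma_k)}_i(w^{(k)}(t))$ for $t$ large. (4) Compute an arbitrary invariant half-line $t\mapsto t\eta^{(k+1)}+v'$ of $f^{(\sigma_{k+1})}$; if $\eta^{(k+1)}\neq\eta^{(k)}$ set $w^{(k+1)}:t\mapsto t\eta^{(k+1)}+v'$ and go to (6). (5) Otherwise (degenerate iteration) set $w^{(k+1)}=Q_{f^{(\sigma_{k+1})}}(w^{(k)})$. (6) Increase $k$ by one and go to (2). *)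

theory Defs
  imports "HOL-Analysis.Analysis"
begin

type_synonym 'n halfline = "(real^'n) \<times> (real^'n)"
  (* (eta, v) represents the half-line t |-> t *\<^sub>R eta + v, considered for t large *)

definition hl :: "'n::finite halfline \<Rightarrow> real \<Rightarrow> real^'n" where
  "hl w t = t *\<^sub>R fst w + snd w"

definition const_vec :: "real \<Rightarrow> real^'n::finite" where
  "const_vec c = (\<chi> i. c)"

definition vle :: "real^'n::finite \<Rightarrow> real^'n \<Rightarrow> bool" where
  "vle x y \<longleftrightarrow> (\<forall>i. x $ i \<le> y $ i)"

definition polyhedral_fun :: "(real^'n::finite \<Rightarrow> real) \<Rightarrow> bool" where
  "polyhedral_fun g \<longleftrightarrow> (\<exists>P. finite P \<and> (\<forall>S\<in>P. polyhedron S) \<and> \<Union>P = UNIV \<and>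
      (\<forall>S\<in>P. \<exists>c d. \<forall>x\<in>S. g x = c \<bullet> x + d))"

definition order_preserving_fun :: "(real^'n::finite \<Rightarrow> real) \<Rightarrow> bool" where
  "order_preserving_fun g \<longleftrightarrow> (\<forall>x y. vle x y \<longrightarrow> g x \<le> g y)"

definition add_homogeneous_fun :: "(real^'n::finite \<Rightarrow> real) \<Rightarrow> bool" where
  "add_homogeneous_fun g \<longleftrightarrow> (\<forall>l x. g (const_vec l + x) = l + g x)"

definition minmap :: "('n::finite \<Rightarrow> 'a set) \<Rightarrow> ('n \<Rightarrow> 'a \<Rightarrow> real^'n \<Rightarrow> real) \<Rightarrow> real^'n \<Rightarrow> real^'n" where
  "minmap A fa x = (\<chi> i. Min ((\<lambda>a. fa i a x) ` A i))"

definition strategies :: "('n::finite \<Rightarrow> 'a set) \<Rightarrow> ('n \<Rightarrow> 'a) set" where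
  "strategies A = {\<sigma>. \<forall>i. \<sigma> i \<in> A i}"

definition strat_map :: "('n::finite \<Rightarrow> 'a \<Rightarrow> real^'n \<Rightarrow> real) \<Rightarrow> ('n \<Rightarrow> 'a) \<Rightarrow> real^'n \<Rightarrow> real^'n" where
  "strat_map fa \<sigma> x = (\<chi> i. fa i (\<sigma> i) x)"

definition invariant_hl :: "(real^'n::finite \<Rightarrow> real^'n) \<Rightarrow> 'n halfline \<Rightarrow> bool" where
  "invariant_hl g w \<longleftrightarrow> (\<forall>\<^sub>F t in at_top. g (hl w t) = hl w (t + 1))"

definition super_invariant_hl :: "(real^'n::finite \<Rightarrow> real^'n) \<Rightarrow> 'n halfline \<Rightarrow> bool" where
  "super_invariant_hl g w \<longleftrightarrow> (\<forall>\<^sub>F t in at_top. vle (g (hl w t)) (hl w (t + 1)))"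

definition hat_map :: "(real^'n::finite \<Rightarrow> real^'n) \<Rightarrow> real^'n \<Rightarrow> real^'n" where
  "hat_map g \<eta> = Lim at_top (\<lambda>t::real. (1 / t) *\<^sub>R g (t *\<^sub>R \<eta>))"

definition hat_map_at :: "(real^'n::finite \<Rightarrow> real^'n) \<Rightarrow> real^'n \<Rightarrow> real^'n \<Rightarrow> real^'n" where
  "hat_map_at g \<eta> v = Lim at_top (\<lambda>t::real. g (t *\<^sub>R \<eta> + v) - t *\<^sub>R hat_map g \<eta>)"

definition bar_map :: "(real^'n::finite \<Rightarrow> real^'n) \<Rightarrow> real^'n \<Rightarrow> real^'n \<Rightarrow> real^'n" where
  "bar_map g \<eta> v = hat_map_at g \<eta> v - \<eta>"

(* Q_g(w) : t |-> t eta + lim_k gbar^k(v), where w : t |-> t eta + v, eta = chi(g) *)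
definition Q_map :: "(real^'n::finite \<Rightarrow> real^'n) \<Rightarrow> 'n halfline \<Rightarrow> 'n halfline" where
  "Q_map g w = (fst w, lim (\<lambda>k. (bar_map g (fst w) ^^ k) (snd w)))"

(* A (partial) run of Algorithm 1 in which N iterations have been performed,
   i.e. the algorithm reached k = N, with strategies sig 0..N and half-lines w 0..N. *)
definition alg1_run ::
  "('n::finite \<Rightarrow> 'a set) \<Rightarrow> ('n \<Rightarrow> 'a \<Rightarrow> real^'n \<Rightarrow> real) \<Rightarrow> nat \<Rightarrow>
   (nat \<Rightarrow> 'n \<Rightarrow> 'a) \<Rightarrow> (nat \<Rightarrow> 'n halfline) \<Rightarrow> bool" where
  "alg1_run A fa N sig w \<longleftrightarrow>
     sig 0 \<in> strategies A \<and> invariant_hl (strat_map fa (sig 0)) (w 0) \<and>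
     (\<forall>k<N.
        \<not> invariant_hl (minmap A fa) (w k) \<and>
        sig (Suc k) \<in> strategies A \<and>
        (\<forall>\<^sub>F t in at_top. minmap A fa (hl (w k) t) = strat_map fa (sig (Suc k)) (hl (w k) t)) \<and>
        (\<forall>i. (\<forall>\<^sub>F t in at_top. minmap A fa (hl (w k) t) $ i = strat_map fa (sig k) (hl (w k) t) $ i)
              \<longrightarrow> sig (Suc k) i = sig k i) \<and>
        (\<exists>w'. invariant_hl (strat_map fa (sig (Suc k))) w' \<and>
           (if fst w' \<noteq> fst (w k) then w (Suc k) = w'
            else w (Suc k) = Q_map (strat_map fa (sig (Suc k))) (w k))))"

end

theory Submission
  imports Defs
begin

text \<open>Along a run the slopes decrease, and the slope is determined by the strategy, so a repetition
  can only occur inside a block of degenerate iterations of common slope \<open>\<eta>\<close>. There the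
  half-lines become fixed points of the bar maps, and their offsets \<open>v\<close> decrease. Call a set \<open>F\<close>
  of coordinates rigid for \<open>h\<close> if \<open>h x \<le> x\<close> on \<open>F\<close> forces equality on \<open>F\<close>; this
  takes the place of the critical nodes, but it depends only on the rows of \<open>h\<close> indexed by
  \<open>F\<close>. Since the choice of strategy is conservative, a set that is rigid for the new bar map
  carries the same actions as before, hence is rigid for the old one, and \<open>v\<close> does not change on
  it. If a strategy recurs, the two offsets are thus fixed points of the same convex map that agree
  on every rigid set; two distinct comparable fixed points differ somewhere on a rigid set, so the
  offsets coincide. By monotonicity the first step of the block was stationary, and the algorithm
  should have stopped there.\<close>

section \<open>Subgradients of convex functions\<close>

text \<open>Separate the epigraph from the open ray below \<open>(v, \<phi> v)\<close>. The
  hyperplane is not vertical because the epigraph lies over the whole space, and its normal,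
  rescaled, is the subgradient.\<close>

lemma subgradient_exists:
  fixes \<phi> :: "'b::euclidean_space \<Rightarrow> real"
  assumes "convex_on UNIV \<phi>"
  obtains p where "\<And>x. \<phi> v + p \<bullet> (x - v) \<le> \<phi> x"
proof -
  let ?E = "epigraph UNIV \<phi>" and ?R = "{v} \<times> {..<\<phi> v}"
  have cE: "convex ?E"
    using assms by (simp add: convex_epigraph)
  have cR: "convex ?R"
    by (simp add: convex_Times)
  have "?E \<inter> ?R = {}"
    by (auto simp: epigraph_def)
  moreover have "?E \<noteq> {}"
    by (auto simp: epigraph_def)
  moreover have "?R \<noteq> {}"
    by (auto intro: exI[of _ "\<phi> v - 1"])
  ultimately obtain a b where a: "a \<noteq> 0" and aE: "\<forall>z\<in>?E. a \<bullet> z \<le> b" and aR: "\<forall>z\<in>?R. a \<bullet> z \<ge> b"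
    using separating_hyperplane_sets[OF cE cR] by blast
  obtain q r where qr: "a = (q, r)" by (cases a)
  have E: "q \<bullet> x + r * y \<le> b" if "\<phi> x \<le> y" for x y
    using aE that by (auto simp: epigraph_def qr)
  have R: "b \<le> q \<bullet> v + r * (\<phi> v - s)" if "s > 0" for s
    using aR that by (auto simp: qr)
  have r0: "r \<le> 0"
    using E[of v "\<phi> v"] R[of 1] by (simp add: algebra_simps)
  \<comment> \<open>A vertical hyperplane is refuted by moving from \<open>v\<close> in its own
    normal direction \<open>q\<close>.\<close>
  have "r \<noteq> 0"
  proof
    assume "r = 0"
    then have "q \<bullet> (v + q) \<le> q \<bullet> v"
      using E[of "v + q" "\<phi> (v + q)"] R[of 1] by simp
    then have "q \<bullet> q \<le> 0" by (simp add: inner_add_right)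
    then have "q = 0" by (metis antisym inner_eq_zero_iff inner_ge_zero)
    with a \<open>r = 0\<close> qr show False by (simp add: zero_prod_def)
  qed
  with r0 have r: "r < 0" by simp
  \<comment> \<open>Let \<open>s\<close> tend to 0 in \<open>R\<close>; \<open>e / (- r)\<close> is
    the \<open>s\<close> that contributes exactly \<open>e\<close>.\<close>
  have b: "b \<le> q \<bullet> v + r * \<phi> v"
  proof (rule field_le_epsilon)
    fix e :: real assume "e > 0"
    then have "0 < e / (- r)" using r by (simp add: divide_pos_neg)
    then show "b \<le> q \<bullet> v + r * \<phi> v + e"
      using R[of "e / (- r)"] r by (simp add: algebra_simps)
  qed
  show ?thesis
  proof
    fix x
    have "q \<bullet> x + r * \<phi> x \<le> q \<bullet> v + r * \<phi> v"
      using E[of x "\<phi> x"] b by simp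
    then have "q \<bullet> (x - v) \<le> (- r) * (\<phi> x - \<phi> v)"
      by (simp add: inner_diff_right algebra_simps)
    then have "q \<bullet> (x - v) / (- r) \<le> \<phi> x - \<phi> v"
      using r by (subst pos_divide_le_eq) (simp_all add: mult.commute)
    then show "\<phi> v + (inverse (- r) *\<^sub>R q) \<bullet> (x - v) \<le> \<phi> x"
      by (simp add: divide_inverse mult.commute)
  qed
qed

section \<open>Order-preserving additively homogeneous maps\<close>

definition topical :: "(real^'n::finite \<Rightarrow> real^'n) \<Rightarrow> bool" where
  "topical h \<longleftrightarrow> (\<forall>i. order_preserving_fun (\<lambda>x. h x $ i) \<and> add_homogeneous_fun (\<lambda>x. h x $ i))"

text \<open>Monotonicity and homogeneity fused into one estimate: nonexpansiveness for the largest
  coordinate difference.\<close>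

lemma topical_le_add:
  assumes "topical h" "\<And>j. x $ j \<le> y $ j + c"
  shows "h x $ i \<le> h y $ i + c"
proof -
  have "vle x (const_vec c + y)"
    using assms(2) by (simp add: vle_def const_vec_def add.commute)
  then have "h x $ i \<le> h (const_vec c + y) $ i"
    using assms(1) by (simp add: topical_def order_preserving_fun_def)
  also have "\<dots> = h y $ i + c"
    using assms(1) by (simp add: topical_def add_homogeneous_fun_def)
  finally show ?thesis .
qed

lemma topical_mono:
  assumes "topical h" "vle x y" shows "vle (h x) (h y)"
  using topical_le_add[OF assms(1), of x y 0] assms(2) by (simp add: vle_def)

lemma topical_diff_le_norm:
  assumes "topical h" shows "h x $ i \<le> h y $ i + norm (x - y)"
proof (rule topical_le_add[OF assms])
  fix j show "x $ j \<le> y $ j + norm (x - y)"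
    using component_le_norm_cart[of "x - y" j] by simp
qed

lemma topical_continuous:
  assumes "topical h" shows "continuous_on UNIV h"
proof (rule continuous_on_vec_lambda[of UNIV "\<lambda>i x. h x $ i", simplified])
  fix i
  show "continuous_on UNIV (\<lambda>x. h x $ i)"
    unfolding continuous_on_iff
  proof (intro ballI allI impI)
    fix x :: "real^'a" and e :: real assume "e > 0"
    have "dist (h y $ i) (h x $ i) \<le> dist y x" for y
      using topical_diff_le_norm[OF assms, of y i x] topical_diff_le_norm[OF assms, of x i y]
      by (simp add: dist_real_def dist_norm norm_minus_commute abs_le_iff)
    then show "\<exists>d>0. \<forall>y\<in>UNIV. dist y x < d \<longrightarrow> dist (h y $ i) (h x $ i) < e"
      using \<open>e > 0\<close> by (meson le_less_trans)
  qed
qed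

section \<open>Rigid sets and the maximum principle\<close>

definition rigid :: "(real^'n::finite \<Rightarrow> real^'n) \<Rightarrow> 'n set \<Rightarrow> bool" where
  "rigid h F \<longleftrightarrow> (\<forall>x. (\<forall>j\<in>F. h x $ j \<le> x $ j) \<longrightarrow> (\<forall>j\<in>F. h x $ j = x $ j))"

lemma rigid_cong:
  assumes "\<And>x j. j \<in> F \<Longrightarrow> h x $ j = h' x $ j"
  shows "rigid h F \<longleftrightarrow> rigid h' F"
  using assms by (simp add: rigid_def)

definition stochastic :: "('n::finite \<Rightarrow> real^'n) \<Rightarrow> bool" where
  "stochastic P \<longleftrightarrow> (\<forall>i j. 0 \<le> P i $ j) \<and> (\<forall>i. (\<Sum>j\<in>UNIV. P i $ j) = 1)"

text \<open>For the Markov chain with rows \<open>P i\<close> these are the closed sets of states;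
  the minimal nonempty ones are the final classes.\<close>

definition absorbing :: "('n::finite \<Rightarrow> real^'n) \<Rightarrow> 'n set \<Rightarrow> bool" where
  "absorbing P F \<longleftrightarrow> (\<forall>i\<in>F. \<forall>j. j \<notin> F \<longrightarrow> P i $ j = 0)"

text \<open>Lowering one coordinate and using monotonicity gives nonnegative entries; homogeneity
  under the shifts by 1 and -1 gives the two inequalities for the row sum.\<close>

lemma stochastic_subgradient:
  assumes h: "topical h" and cvx: "\<And>i. convex_on UNIV (\<lambda>x. h x $ i)"
  obtains P where "stochastic P" "\<And>i x. h v $ i + P i \<bullet> (x - v) \<le> h x $ i"
proof -
  have "\<exists>p. \<forall>x. h v $ i + p \<bullet> (x - v) \<le> h x $ i" for i
    using subgradient_exists[OF cvx[of i], of v] by metis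
  then obtain P where P: "\<And>i x. h v $ i + P i \<bullet> (x - v) \<le> h x $ i"
    by metis
  have "0 \<le> P i $ j" for i j
  proof -
    have "h (v - axis j 1) $ i \<le> h v $ i"
      using topical_le_add[OF h, of "v - axis j 1" v 0] by (simp add: axis_def)
    with P[of i "v - axis j 1"] show ?thesis by (simp add: inner_axis)
  qed
  moreover have "(\<Sum>j\<in>UNIV. P i $ j) = 1" for i
  proof -
    have s: "P i \<bullet> const_vec c = c * (\<Sum>j\<in>UNIV. P i $ j)" for c
      by (simp add: inner_vec_def const_vec_def sum_distrib_left mult.commute)
    have t: "h (const_vec c + v) $ i = c + h v $ i" for c
      using h by (simp add: topical_def add_homogeneous_fun_def)
    show ?thesis
      using P[of i "const_vec 1 + v"] P[of i "const_vec (-1) + v"] by (simp add: s t)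
  qed
  ultimately show ?thesis
    using P by (intro that[of P]) (simp_all add: stochastic_def)
qed

text \<open>Maximum principle: where \<open>y\<close> equals \<open>M\<close>, an average over
  \<open>F\<close> of values at most \<open>M\<close> is at least \<open>M\<close>, so no weight
  falls on smaller values.\<close>

lemma absorbing_argmax:
  assumes P: "stochastic P" and F: "absorbing P F"
    and sub: "\<And>i. i \<in> F \<Longrightarrow> y $ i \<le> P i \<bullet> y" and M: "\<And>i. i \<in> F \<Longrightarrow> y $ i \<le> M"
  shows "absorbing P {i \<in> F. y $ i = M}"
  unfolding absorbing_def
proof (intro ballI allI impI)
  fix i j assume i: "i \<in> {i \<in> F. y $ i = M}" and j: "j \<notin> {i \<in> F. y $ i = M}"
  have nonneg: "0 \<le> P i $ l * (M - y $ l)" for l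
    using P F M[of l] i by (cases "l \<in> F") (auto simp: stochastic_def absorbing_def)
  have "(\<Sum>l\<in>UNIV. P i $ l * (M - y $ l)) = M * (\<Sum>l\<in>UNIV. P i $ l) - P i \<bullet> y"
    by (simp add: inner_vec_def sum_distrib_left algebra_simps sum_subtractf)
  also have "\<dots> \<le> 0"
    using P sub[of i] i by (simp add: stochastic_def)
  finally have "(\<Sum>l\<in>UNIV. P i $ l * (M - y $ l)) = 0"
    using nonneg by (simp add: antisym sum_nonneg)
  then have "P i $ j * (M - y $ j) = 0"
    using nonneg by (simp add: sum_nonneg_eq_0_iff)
  then show "P i $ j = 0"
    using j F i by (auto simp: absorbing_def)
qed

lemma stochastic_inner_const:
  assumes "stochastic P" "absorbing P F" "i \<in> F" "\<And>j. j \<in> F \<Longrightarrow> y $ j = M"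
  shows "P i \<bullet> y = M"
proof -
  have "P i \<bullet> y = (\<Sum>j\<in>UNIV. P i $ j * M)"
    unfolding inner_vec_def using assms by (intro sum.cong) (auto simp: absorbing_def)
  also have "\<dots> = M"
    using assms(1) by (simp add: stochastic_def flip: sum_distrib_right)
  finally show ?thesis .
qed

text \<open>The witness is a final class of a stochastic subgradient at \<open>v\<close>, chosen inside the set where
  \<open>v - u\<close> is maximal.\<close>

lemma rigid_set_exists:
  assumes h: "topical h" and cvx: "\<And>i. convex_on UNIV (\<lambda>x. h x $ i)"
    and v: "h v = v" and u: "vle (h u) u" and "vle u v" "u \<noteq> v"
  obtains F i where "rigid h F" "i \<in> F" "u $ i \<noteq> v $ i"
proof -
  obtain P where P: "stochastic P" and sg: "\<And>i x. v $ i + P i \<bullet> (x - v) \<le> h x $ i"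
    using stochastic_subgradient[OF h cvx, of v] v by metis
  \<comment> \<open>Since \<open>h v = v\<close>, wherever \<open>h x \<le> x\<close> the vector
    \<open>v - x\<close> is subharmonic for \<open>P\<close>, as the maximum principle
    requires.\<close>
  have sub: "(v - x) $ i \<le> P i \<bullet> (v - x)" if "h x $ i \<le> x $ i" for x i
    using sg[of i x] that by (simp add: inner_diff_right)
  define M where "M = Max (range (($) (v - u)))"
  have M: "(v - u) $ i \<le> M" for i by (auto simp: M_def)
  define D where "D = {i \<in> UNIV. (v - u) $ i = M}"
  have "absorbing P D"
    unfolding D_def using u M by (intro absorbing_argmax P sub) (auto simp: absorbing_def vle_def)
  moreover have "D \<noteq> {}"
    using Max_in[of "range (($) (v - u))"] unfolding D_def M_def by fastforce
  ultimately obtain F where F: "absorbing P F" "F \<noteq> {}" "F \<subseteq> D"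
    and min: "\<And>F'. absorbing P F' \<Longrightarrow> F' \<noteq> {} \<Longrightarrow> F' \<subseteq> F \<Longrightarrow> F' = F"
    using finite_has_minimal2[of "{F. absorbing P F \<and> F \<noteq> {}}" D] by (auto simp: finite)
  have "rigid h F"
    unfolding rigid_def
  proof (intro allI impI ballI)
    fix x i assume x: "\<forall>j\<in>F. h x $ j \<le> x $ j" and i: "i \<in> F"
    define m where "m = Max (($) (v - x) ` F)"
    have "absorbing P {j \<in> F. (v - x) $ j = m}"
      using x by (intro absorbing_argmax P F sub) (auto simp: m_def)
    moreover have "{j \<in> F. (v - x) $ j = m} \<noteq> {}"
      using Max_in[of "($) (v - x) ` F"] F(2) unfolding m_def by fastforce
    \<comment> \<open>By minimality of \<open>F\<close>, \<open>v - x\<close> is constant on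
      \<open>F\<close>. Averaging with \<open>P i\<close> then reproduces its value at
      \<open>i\<close>, and the subgradient inequality becomes \<open>x \<le> h x\<close>
      there.\<close>
    ultimately have eq: "{j \<in> F. (v - x) $ j = m} = F"
      by (intro min) auto
    then have "P i \<bullet> (v - x) = m"
      by (intro stochastic_inner_const[OF P F(1) i]) blast
    moreover have "(v - x) $ i = m" using eq i by blast
    ultimately have "x $ i \<le> h x $ i"
      using sg[of i x] by (simp add: inner_diff_right)
    then show "h x $ i = x $ i" using x i by (simp add: antisym)
  qed
  moreover obtain i where i: "i \<in> F" using F(2) by blast
  \<comment> \<open>\<open>F\<close> lies where \<open>v - u\<close> is maximal, so equality at
    \<open>i\<close> would make this maximum 0 and force \<open>v \<le> u\<close>.\<close>
  moreover have "u $ i \<noteq> v $ i"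
  proof
    assume "u $ i = v $ i"
    then have "M = 0" using i F(3) by (auto simp: D_def)
    then have "v $ j = u $ j" for j
      using M[of j] \<open>vle u v\<close> by (simp add: vle_def antisym)
    with \<open>u \<noteq> v\<close> show False by (simp add: vec_eq_iff)
  qed
  ultimately show ?thesis using that by blast
qed

section \<open>Asymptotics along half-lines\<close>

lemma bounded_arith_progression_slope:
  fixes c d K :: real
  assumes "\<And>m::nat. real m * c + d \<le> K" shows "c \<le> 0"
proof (rule ccontr)
  assume "\<not> c \<le> 0"
  then obtain m :: nat where "K - d < real m * c"
    using reals_Archimedean3[of c] by auto
  with assms[of m] show False by simp
qed

text \<open>One of the finitely many pieces is visited at arbitrarily large times; being convex, it
  contains a whole tail of the ray.\<close>

lemma polyhedral_fun_along_ray: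
  assumes "polyhedral_fun g"
  obtains a b where "\<forall>\<^sub>F t in at_top. g (t *\<^sub>R \<eta> + v) = t * a + b"
proof -
  obtain \<P> where "finite \<P> \<and> (\<forall>S\<in>\<P>. polyhedron S) \<and> \<Union>\<P> = UNIV
      \<and> (\<forall>S\<in>\<P>. \<exists>c d. \<forall>x\<in>S. g x = c \<bullet> x + d)"
    using assms unfolding polyhedral_fun_def by (elim exE)
  then have P: "finite \<P>" "\<And>S. S \<in> \<P> \<Longrightarrow> polyhedron S" "\<Union>\<P> = UNIV"
    and aff: "\<And>S. S \<in> \<P> \<Longrightarrow> \<exists>c d. \<forall>x\<in>S. g x = c \<bullet> x + d"
    by blast+
  have "\<exists>S\<in>\<P>. \<exists>\<^sub>F t in at_top. t *\<^sub>R \<eta> + v \<in> S"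
  proof (rule ccontr)
    assume "\<not> ?thesis"
    then have "\<forall>\<^sub>F t in at_top. \<forall>S\<in>\<P>. t *\<^sub>R \<eta> + v \<notin> S"
      using P(1) by (simp add: frequently_def eventually_ball_finite)
    then have "\<forall>\<^sub>F t::real in at_top. False"
      by eventually_elim (use P(3) in blast)
    then show False by simp
  qed
  then obtain S where S: "S \<in> \<P>" and fr: "\<exists>\<^sub>F t in at_top. t *\<^sub>R \<eta> + v \<in> S" by blast
  from fr obtain T where T: "T *\<^sub>R \<eta> + v \<in> S" by (auto dest: frequently_ex)
  have "t *\<^sub>R \<eta> + v \<in> S" if "t \<ge> T" for t
  proof -
    obtain t' where t': "t' > t" "t' *\<^sub>R \<eta> + v \<in> S"
      using frequently_eventually_frequently[OF fr eventually_gt_at_top[of t]]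
      by (auto dest: frequently_ex)
    define s where "s = (t - T) / (t' - T)"
    have s: "0 \<le> s" "s \<le> 1" using that t' by (auto simp: s_def)
    have "(1 - s) *\<^sub>R (T *\<^sub>R \<eta> + v) + s *\<^sub>R (t' *\<^sub>R \<eta> + v) = (T + s * (t' - T)) *\<^sub>R \<eta> + v"
      by (simp add: algebra_simps)
    also have "T + s * (t' - T) = t" using that t' by (simp add: s_def)
    finally show ?thesis
      using convexD_alt[OF polyhedron_imp_convex[OF P(2)[OF S]] T t'(2) s] by simp
  qed
  moreover obtain c d where "\<forall>x\<in>S. g x = c \<bullet> x + d" using aff[OF S] by blast
  ultimately have "\<forall>t\<ge>T. g (t *\<^sub>R \<eta> + v) = t * (c \<bullet> \<eta>) + (c \<bullet> v + d)"
    by (simp add: inner_add_right)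
  then show ?thesis
    using that by (auto simp: eventually_at_top_linorder)
qed

text \<open>By nonexpansiveness the excess of \<open>w'\<close> over \<open>w\<close> at the times
  \<open>T + m\<close> never grows beyond its initial bound, while it changes linearly with the
  difference of slopes.\<close>

lemma slope_mono:
  assumes g: "topical g" and inv: "invariant_hl g w'" and sup: "super_invariant_hl g w"
  shows "vle (fst w') (fst w)"
proof -
  have "\<forall>\<^sub>F t in at_top. g (hl w' t) = hl w' (t + 1) \<and> vle (g (hl w t)) (hl w (t + 1))"
    using inv sup by (simp add: invariant_hl_def super_invariant_hl_def eventually_conj)
  then obtain T where T: "\<And>t. t \<ge> T \<Longrightarrow> g (hl w' t) = hl w' (t + 1)"
    "\<And>t. t \<ge> T \<Longrightarrow> vle (g (hl w t)) (hl w (t + 1))"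
    by (auto simp: eventually_at_top_linorder)
  define c where "c = norm (hl w' T - hl w T)"
  have D: "hl w' (T + real m) $ i \<le> hl w (T + real m) $ i + c" for m i
  proof (induction m arbitrary: i)
    case 0
    show ?case
      using component_le_norm_cart[of "hl w' T - hl w T" i] by (simp add: c_def)
  next
    case (Suc m)
    have "hl w' (T + real m + 1) $ i = g (hl w' (T + real m)) $ i" using T(1) by simp
    also have "\<dots> \<le> g (hl w (T + real m)) $ i + c" by (rule topical_le_add[OF g Suc])
    also have "\<dots> \<le> hl w (T + real m + 1) $ i + c"
      using T(2)[of "T + real m"] by (simp add: vle_def)
    finally show ?case by (simp add: ac_simps)
  qed
  have "fst w' $ i - fst w $ i \<le> 0" for i
  proof (rule bounded_arith_progression_slope)
    fix m
    show "real m * (fst w' $ i - fst w $ i) + (hl w' T $ i - hl w T $ i) \<le> c"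
      using D[of m i] by (simp add: hl_def algebra_simps)
  qed
  then show ?thesis by (simp add: vle_def)
qed

lemma invariant_imp_super_invariant: "invariant_hl g w \<Longrightarrow> super_invariant_hl g w"
  unfolding invariant_hl_def super_invariant_hl_def by (erule eventually_mono) (simp add: vle_def)

lemma vle_antisym: "vle x y \<Longrightarrow> vle y x \<Longrightarrow> x = y"
  by (simp add: vle_def vec_eq_iff antisym)

lemma vle_trans: "vle x y \<Longrightarrow> vle y z \<Longrightarrow> vle x z"
  unfolding vle_def by (meson order_trans)

text \<open>Stands in for the cycle time: each half-line bounds the slope of the other.\<close>

lemma slope_unique:
  assumes "topical g" "invariant_hl g w" "invariant_hl g w'"
  shows "fst w = fst w'"
  by (intro vle_antisym slope_mono[OF assms(1)] invariant_imp_super_invariant assms)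

section \<open>The bar map at the slope\<close>

text \<open>\<open>inv_ex\<close> expresses that \<open>\<eta>\<close> is the cycle time of
  \<open>g\<close>. In a run, the algorithm supplies the invariant half-line.\<close>

locale polyhedral_topical =
  fixes g :: "real^'n::finite \<Rightarrow> real^'n" and \<eta> :: "real^'n"
  assumes top: "topical g" and poly: "\<And>i. polyhedral_fun (\<lambda>x. g x $ i)"
    and inv_ex: "\<exists>v. invariant_hl g (\<eta>, v)"
begin

text \<open>Polyhedrality makes each coordinate eventually affine in \<open>t\<close>;
  nonexpansiveness keeps it at bounded distance from the invariant ray, so its slope is that of
  \<open>\<eta>\<close>.\<close>

lemma along_ray: "\<exists>b. \<forall>\<^sub>F t in at_top. g (t *\<^sub>R \<eta> + v) = t *\<^sub>R \<eta> + b"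
proof -
  have "\<exists>a b. \<forall>\<^sub>F t in at_top. g (t *\<^sub>R \<eta> + v) $ i = t * a + b" for i
    using polyhedral_fun_along_ray[OF poly[of i], of \<eta> v] by metis
  then obtain a b where "\<And>i. \<forall>\<^sub>F t in at_top. g (t *\<^sub>R \<eta> + v) $ i = t * a i + b i"
    by metis
  then have ab: "\<forall>\<^sub>F t in at_top. \<forall>i. g (t *\<^sub>R \<eta> + v) $ i = t * a i + b i"
    by (rule eventually_all_finite)
  obtain v' where "invariant_hl g (\<eta>, v')" using inv_ex by blast
  then have "\<forall>\<^sub>F t in at_top. g (t *\<^sub>R \<eta> + v') = (t + 1) *\<^sub>R \<eta> + v'"
    by (simp add: invariant_hl_def hl_def)
  with ab have "\<forall>\<^sub>F t in at_top. (\<forall>i. g (t *\<^sub>R \<eta> + v) $ i = t * a i + b i)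
      \<and> g (t *\<^sub>R \<eta> + v') = (t + 1) *\<^sub>R \<eta> + v'"
    by (rule eventually_conj)
  then obtain T where "\<forall>t\<ge>T. (\<forall>i. g (t *\<^sub>R \<eta> + v) $ i = t * a i + b i)
      \<and> g (t *\<^sub>R \<eta> + v') = (t + 1) *\<^sub>R \<eta> + v'"
    unfolding eventually_at_top_linorder by (elim exE)
  then have T: "\<And>t i. t \<ge> T \<Longrightarrow> g (t *\<^sub>R \<eta> + v) $ i = t * a i + b i"
    "\<And>t. t \<ge> T \<Longrightarrow> g (t *\<^sub>R \<eta> + v') = (t + 1) *\<^sub>R \<eta> + v'"
    by simp_all
  have a: "a i = \<eta> $ i" for i
  proof (rule antisym)
    have "a i - \<eta> $ i \<le> 0"
    proof (rule bounded_arith_progression_slope)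
      fix m
      show "real m * (a i - \<eta> $ i) + (T * a i + b i - (T + 1) * \<eta> $ i - v' $ i) \<le> norm (v - v')"
        using topical_diff_le_norm[OF top, of "(T + real m) *\<^sub>R \<eta> + v" i "(T + real m) *\<^sub>R \<eta> + v'"]
          T[of "T + real m"] by (simp add: algebra_simps)
    qed
    then show "a i \<le> \<eta> $ i" by simp
    have "\<eta> $ i - a i \<le> 0"
    proof (rule bounded_arith_progression_slope)
      fix m
      show "real m * (\<eta> $ i - a i) + - (T * a i + b i - (T + 1) * \<eta> $ i - v' $ i) \<le> norm (v' - v)"
        using topical_diff_le_norm[OF top, of "(T + real m) *\<^sub>R \<eta> + v'" i "(T + real m) *\<^sub>R \<eta> + v"]
          T[of "T + real m"] by (simp add: algebra_simps)
    qed
    then show "\<eta> $ i \<le> a i" by simp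
  qed
  from ab have "\<forall>\<^sub>F t in at_top. g (t *\<^sub>R \<eta> + v) = t *\<^sub>R \<eta> + (\<chi> i. b i)"
    by eventually_elim (simp add: vec_eq_iff a)
  then show ?thesis by blast
qed

lemma hat_map_slope: "hat_map g \<eta> = \<eta>"
proof -
  obtain b where "\<forall>\<^sub>F t in at_top. g (t *\<^sub>R \<eta> + 0) = t *\<^sub>R \<eta> + b" using along_ray by blast
  then have "\<forall>\<^sub>F t in at_top. \<eta> + (1 / t) *\<^sub>R b = (1 / t) *\<^sub>R g (t *\<^sub>R \<eta>)"
    using eventually_gt_at_top[of 0] by eventually_elim (simp add: algebra_simps)
  moreover have "((\<lambda>t::real. \<eta> + (1 / t) *\<^sub>R b) \<longlongrightarrow> \<eta> + 0 *\<^sub>R b) at_top"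
    by (intro tendsto_intros tendsto_divide_0[OF tendsto_const] filterlim_at_top_imp_at_infinity
        filterlim_ident)
  ultimately have "((\<lambda>t. (1 / t) *\<^sub>R g (t *\<^sub>R \<eta>)) \<longlongrightarrow> \<eta>) at_top"
    by (auto intro: Lim_transform_eventually)
  then show ?thesis
    unfolding hat_map_def by (intro tendsto_Lim) simp_all
qed

text \<open>The limit defining the bar map is attained at all large \<open>t\<close>. Properties of
  \<open>g\<close> therefore pass to \<open>bar_map g \<eta>\<close> by evaluation at a single large
  time.\<close>

lemma eventually_bar_map: "\<forall>\<^sub>F t in at_top. g (t *\<^sub>R \<eta> + v) = (t + 1) *\<^sub>R \<eta> + bar_map g \<eta> v"
proof -
  obtain b where b: "\<forall>\<^sub>F t in at_top. g (t *\<^sub>R \<eta> + v) = t *\<^sub>R \<eta> + b" using along_ray by blast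
  then have "\<forall>\<^sub>F t in at_top. b = g (t *\<^sub>R \<eta> + v) - t *\<^sub>R hat_map g \<eta>"
    by eventually_elim (simp add: hat_map_slope)
  then have "((\<lambda>t. g (t *\<^sub>R \<eta> + v) - t *\<^sub>R hat_map g \<eta>) \<longlongrightarrow> b) at_top"
    by (rule Lim_transform_eventually[OF tendsto_const])
  then have "hat_map_at g \<eta> v = b"
    unfolding hat_map_at_def by (intro tendsto_Lim) simp_all
  with b show ?thesis by (simp add: bar_map_def algebra_simps)
qed

lemma bar_map_component_eqI:
  assumes "\<forall>\<^sub>F t in at_top. g (t *\<^sub>R \<eta> + v) $ i = (t + 1) * \<eta> $ i + c"
  shows "bar_map g \<eta> v $ i = c"
proof -
  have "\<forall>\<^sub>F t::real in at_top. bar_map g \<eta> v $ i = c"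
    using assms eventually_bar_map[of v] by eventually_elim simp
  then show ?thesis by simp
qed

lemma invariant_iff: "invariant_hl g (\<eta>, v) \<longleftrightarrow> bar_map g \<eta> v = v"
proof
  assume "invariant_hl g (\<eta>, v)"
  then have "\<forall>\<^sub>F t::real in at_top. bar_map g \<eta> v = v"
    using eventually_bar_map[of v] unfolding invariant_hl_def
    by eventually_elim (simp add: hl_def)
  then show "bar_map g \<eta> v = v" by simp
next
  assume "bar_map g \<eta> v = v"
  then show "invariant_hl g (\<eta>, v)"
    using eventually_bar_map[of v] by (simp add: invariant_hl_def hl_def)
qed

lemma super_invariant_imp:
  assumes "super_invariant_hl g (\<eta>, v)" shows "vle (bar_map g \<eta> v) v"
proof -
  from assms have "\<forall>\<^sub>F t::real in at_top. vle (bar_map g \<eta> v) v"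
    using eventually_bar_map[of v] unfolding super_invariant_hl_def
    by eventually_elim (simp add: hl_def vle_def)
  then show ?thesis by simp
qed

lemma topical_bar_map: "topical (bar_map g \<eta>)"
  unfolding topical_def
proof (intro allI conjI)
  fix i
  show "order_preserving_fun (\<lambda>x. bar_map g \<eta> x $ i)"
    unfolding order_preserving_fun_def
  proof (intro allI impI)
    fix x y :: "real^'n" assume "vle x y"
    then have le: "vle (g (t *\<^sub>R \<eta> + x)) (g (t *\<^sub>R \<eta> + y))" for t
      by (intro topical_mono[OF top]) (simp add: vle_def)
    have "\<forall>\<^sub>F t::real in at_top. bar_map g \<eta> x $ i \<le> bar_map g \<eta> y $ i"
      using eventually_bar_map[of x] eventually_bar_map[of y]
    proof eventually_elim
      case (elim t)
      show ?case using le[of t] by (simp add: elim vle_def)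
    qed
    then show "bar_map g \<eta> x $ i \<le> bar_map g \<eta> y $ i" by simp
  qed
  show "add_homogeneous_fun (\<lambda>x. bar_map g \<eta> x $ i)"
    unfolding add_homogeneous_fun_def
  proof (intro allI bar_map_component_eqI)
    fix l x
    have "g (t *\<^sub>R \<eta> + (const_vec l + x)) $ i = l + g (t *\<^sub>R \<eta> + x) $ i" for t
      using top unfolding topical_def add_homogeneous_fun_def by (metis add.left_commute)
    with eventually_bar_map[of x] show "\<forall>\<^sub>F t in at_top.
        g (t *\<^sub>R \<eta> + (const_vec l + x)) $ i = (t + 1) * \<eta> $ i + (l + bar_map g \<eta> x $ i)"
      by (auto elim!: eventually_mono)
  qed
qed

lemma convex_bar_map:
  assumes "convex_on UNIV (\<lambda>x. g x $ i)"
  shows "convex_on UNIV (\<lambda>x. bar_map g \<eta> x $ i)"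
proof (rule convex_onI)
  fix s :: real and x y :: "real^'n" assume s: "0 < s" "s < 1"
  let ?z = "(1 - s) *\<^sub>R x + s *\<^sub>R y"
  have z: "t *\<^sub>R \<eta> + ?z = (1 - s) *\<^sub>R (t *\<^sub>R \<eta> + x) + s *\<^sub>R (t *\<^sub>R \<eta> + y)" for t
    by (simp add: algebra_simps)
  have le: "g (t *\<^sub>R \<eta> + ?z) $ i \<le> (1 - s) * g (t *\<^sub>R \<eta> + x) $ i + s * g (t *\<^sub>R \<eta> + y) $ i" for t
    unfolding z using s by (intro convex_onD[OF assms]) auto
  have "\<forall>\<^sub>F t::real in at_top.
      bar_map g \<eta> ?z $ i \<le> (1 - s) * bar_map g \<eta> x $ i + s * bar_map g \<eta> y $ i"
    using eventually_bar_map[of x] eventually_bar_map[of y] eventually_bar_map[of ?z]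
  proof eventually_elim
    case (elim t)
    from le[of t] show ?case
      unfolding elim by (simp add: algebra_simps)
  qed
  then show "bar_map g \<eta> ?z $ i \<le> (1 - s) * bar_map g \<eta> x $ i + s * bar_map g \<eta> y $ i"
    by simp
qed simp

text \<open>The iterates of the bar map decrease from \<open>v\<close> and are bounded below, so
  they converge, and by continuity the limit is a fixed point. Each iterate satisfies
  \<open>b x \<le> x\<close>, so on a rigid set nothing moves.\<close>

lemma Q_map_super_invariant:
  assumes "super_invariant_hl g (\<eta>, v)"
  defines "u \<equiv> snd (Q_map g (\<eta>, v))"
  shows "invariant_hl g (\<eta>, u)" and "vle u v"
    and "rigid (bar_map g \<eta>) F \<Longrightarrow> i \<in> F \<Longrightarrow> u $ i = v $ i"
proof -
  define b where "b = bar_map g \<eta>"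
  have top_b: "topical b" unfolding b_def by (rule topical_bar_map)
  define X where "X k = (b ^^ k) v" for k
  have step: "vle (X (Suc k)) (X k)" for k
  proof (induction k)
    case 0
    show ?case using super_invariant_imp[OF assms(1)] by (simp add: X_def b_def)
  next
    case (Suc k)
    then show ?case using topical_mono[OF top_b Suc] by (simp add: X_def)
  qed
  obtain v' where "invariant_hl g (\<eta>, v')" using inv_ex by blast
  then have v': "b v' = v'" by (simp add: invariant_iff b_def)
  \<comment> \<open>The fixed point \<open>v'\<close>, shifted down below \<open>v\<close>, stays
    below all iterates.\<close>
  have low: "v' $ i - norm (v' - v) \<le> X k $ i" for k i
  proof (induction k arbitrary: i)
    case 0
    show ?case using component_le_norm_cart[of "v' - v" i] by (simp add: X_def)
  next
    case (Suc k)
    have "b v' $ i \<le> b (X k) $ i + norm (v' - v)"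
      using Suc by (intro topical_le_add[OF top_b]) (simp add: algebra_simps)
    then show ?case by (simp add: v' X_def)
  qed
  have dec: "decseq (\<lambda>k. X k $ i)" for i
    using step by (auto intro!: decseq_SucI simp: vle_def)
  have "\<exists>l. (\<lambda>k. X k $ i) \<longlonglongrightarrow> l \<and> (\<forall>k. l \<le> X k $ i)" for i
    using decseq_convergent[OF dec[of i], of "v' $ i - norm (v' - v)"] low by metis
  then obtain l where l: "\<And>i. (\<lambda>k. X k $ i) \<longlonglongrightarrow> l i" "\<And>i k. l i \<le> X k $ i"
    by metis
  have "X \<longlonglongrightarrow> (\<chi> i. l i)"
    using l(1) by (intro vec_tendstoI) simp
  \<comment> \<open>Only now that convergence is known does \<open>lim\<close> in
    \<open>Q_map\<close> denote the limit.\<close>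
  then have lim: "X \<longlonglongrightarrow> u"
    using limI[of X] by (simp add: Q_map_def u_def b_def X_def[abs_def])
  have "(\<lambda>k. b (X k)) \<longlonglongrightarrow> b u"
    using continuous_on_tendsto_compose[OF topical_continuous[OF top_b] lim] by simp
  then have "(\<lambda>k. X (Suc k)) \<longlonglongrightarrow> b u" by (simp add: X_def)
  then have "b u = u" by (rule LIMSEQ_unique[OF _ LIMSEQ_Suc[OF lim]])
  then show "invariant_hl g (\<eta>, u)" by (simp add: invariant_iff b_def)
  have "u $ i = l i" for i
    using LIMSEQ_unique[OF tendsto_vec_nth[OF lim] l(1)] .
  then show "vle u v" using l(2)[of _ 0] by (simp add: vle_def X_def)
  assume F: "rigid (bar_map g \<eta>) F" and i: "i \<in> F"
  have "X (Suc k) $ i = X k $ i" for k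
    using F i step[of k] by (simp add: rigid_def vle_def X_def b_def)
  then have "X k $ i = v $ i" for k
    by (induction k) (simp_all add: X_def)
  then show "u $ i = v $ i"
    using LIMSEQ_unique[OF tendsto_vec_nth[OF lim, of i]] by simp
qed

end

section \<open>Runs of the algorithm\<close>

locale policy_iteration =
  fixes A :: "'n::finite \<Rightarrow> 'a set"
    and fa :: "'n \<Rightarrow> 'a \<Rightarrow> real^'n \<Rightarrow> real"
    and N :: nat and sig :: "nat \<Rightarrow> 'n \<Rightarrow> 'a" and w :: "nat \<Rightarrow> 'n halfline"
  assumes fin: "\<And>i. finite (A i)"
    and poly: "\<And>i a. a \<in> A i \<Longrightarrow> polyhedral_fun (fa i a)"
    and op: "\<And>i a. a \<in> A i \<Longrightarrow> order_preserving_fun (fa i a)"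
    and ah: "\<And>i a. a \<in> A i \<Longrightarrow> add_homogeneous_fun (fa i a)"
    and cvx: "\<And>i a. a \<in> A i \<Longrightarrow> convex_on UNIV (fa i a)"
    and run: "alg1_run A fa N sig w"
begin

abbreviation "g k \<equiv> strat_map fa (sig k)"

lemma strategy: "k \<le> N \<Longrightarrow> sig k \<in> strategies A"
  using run by (cases k) (auto simp: alg1_run_def)

lemma action: "k \<le> N \<Longrightarrow> sig k i \<in> A i"
  using strategy by (simp add: strategies_def)

lemma topical_g: "k \<le> N \<Longrightarrow> topical (g k)"
  using op ah action by (simp add: topical_def strat_map_def)

lemma convex_g: "k \<le> N \<Longrightarrow> convex_on UNIV (\<lambda>x. g k x $ i)"
  using cvx action by (simp add: strat_map_def)

lemma polyhedral_topical_g: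
  assumes "k \<le> N" "invariant_hl (g k) u" "fst u = \<eta>"
  shows "polyhedral_topical (g k) \<eta>"
proof
  show "topical (g k)" using assms(1) by (rule topical_g)
  show "polyhedral_fun (\<lambda>x. g k x $ i)" for i
    using poly action[OF assms(1)] by (simp add: strat_map_def)
  show "\<exists>v. invariant_hl (g k) (\<eta>, v)"
    using assms(2,3) by (metis prod.collapse)
qed

lemma improvement:
  "k < N \<Longrightarrow> \<forall>\<^sub>F t in at_top. minmap A fa (hl (w k) t) = g (Suc k) (hl (w k) t)"
  using run by (simp add: alg1_run_def)

lemma conservative:
  assumes "k < N"
    and "\<forall>\<^sub>F t in at_top. minmap A fa (hl (w k) t) $ i = g k (hl (w k) t) $ i"
  shows "sig (Suc k) i = sig k i"
  using run assms by (simp add: alg1_run_def)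

lemma next_halfline:
  assumes "k < N"
  obtains w' where "invariant_hl (g (Suc k)) w'"
    "if fst w' \<noteq> fst (w k) then w (Suc k) = w' else w (Suc k) = Q_map (g (Suc k)) (w k)"
  using run assms unfolding alg1_run_def by blast

text \<open>The minimum lies below \<open>g k\<close> everywhere and agrees with
  \<open>g (Suc k)\<close> along \<open>w k\<close>. Through \<open>slope_mono\<close> this makes
  the slopes decrease.\<close>

lemma super_invariant_step:
  assumes k: "k < N" and inv: "invariant_hl (g k) (w k)"
  shows "super_invariant_hl (g (Suc k)) (w k)"
proof -
  have min_le: "vle (minmap A fa x) (g k x)" for x
    using fin action[of k] k by (auto simp: vle_def minmap_def strat_map_def intro!: Min_le)
  show ?thesis
    using improvement[OF k] inv unfolding invariant_hl_def super_invariant_hl_def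
    by eventually_elim (metis min_le)
qed

text \<open>A nondegenerate iteration takes an invariant half-line outright; in a degenerate one
  \<open>Q_map\<close> makes the super-invariant \<open>w k\<close> invariant.\<close>

lemma invariant_w: "k \<le> N \<Longrightarrow> invariant_hl (g k) (w k)"
proof (induction k)
  case 0
  show ?case using run by (simp add: alg1_run_def)
next
  case (Suc k)
  then have k: "k < N" and sup: "super_invariant_hl (g (Suc k)) (w k)"
    using super_invariant_step by auto
  obtain w' where w': "invariant_hl (g (Suc k)) w'"
    "if fst w' \<noteq> fst (w k) then w (Suc k) = w' else w (Suc k) = Q_map (g (Suc k)) (w k)"
    using next_halfline[OF k] .
  show ?case
  proof (cases "fst w' = fst (w k)")
    case True
    then interpret polyhedral_topical "g (Suc k)" "fst (w k)"
      using polyhedral_topical_g Suc.prems w'(1) by blast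
    have "fst (Q_map (g (Suc k)) (w k)) = fst (w k)" by (simp add: Q_map_def)
    then show ?thesis
      using Q_map_super_invariant(1)[of "snd (w k)"] sup w'(2) True by (metis prod.collapse)
  qed (use w' in simp)
qed

lemma slope_decreasing: "k < N \<Longrightarrow> vle (fst (w (Suc k))) (fst (w k))"
  using slope_mono[OF topical_g[of "Suc k"] invariant_w[of "Suc k"]]
    super_invariant_step invariant_w[of k] by simp

lemma slope_antimono:
  assumes "j \<le> k" "k \<le> N" shows "vle (fst (w k)) (fst (w j))"
  using assms
proof (induction k rule: dec_induct)
  case base
  show ?case by (simp add: vle_def)
next
  case (step k)
  then show ?case using slope_decreasing[of k] by (auto intro: vle_trans)
qed

text \<open>Rigidity passes from the new map back to the old one, so it can be carried from the end
  of a degenerate block to its start.\<close>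

lemma degenerate_step:
  assumes k: "k < N" and \<eta>: "fst (w k) = \<eta>" "fst (w (Suc k)) = \<eta>"
  shows "vle (snd (w (Suc k))) (snd (w k))"
    and "rigid (bar_map (g (Suc k)) \<eta>) F \<Longrightarrow> rigid (bar_map (g k) \<eta>) F"
    and "rigid (bar_map (g (Suc k)) \<eta>) F \<Longrightarrow> i \<in> F \<Longrightarrow> snd (w (Suc k)) $ i = snd (w k) $ i"
    and "w (Suc k) \<noteq> w k"
proof -
  have inv: "invariant_hl (g k) (w k)" and inv': "invariant_hl (g (Suc k)) (w (Suc k))"
    using invariant_w k by auto
  interpret old: polyhedral_topical "g k" \<eta>
    using polyhedral_topical_g inv \<eta> k by simp
  interpret new: polyhedral_topical "g (Suc k)" \<eta>
    using polyhedral_topical_g inv' \<eta> k by simp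
  have wk: "w k = (\<eta>, snd (w k))" using \<eta> by (simp add: prod_eq_iff)
  have sup: "super_invariant_hl (g (Suc k)) (\<eta>, snd (w k))"
    using super_invariant_step[OF k inv] wk by simp
  \<comment> \<open>Equal slopes exclude the other branch, which would set \<open>w (Suc k)\<close>
    to a half-line of different slope.\<close>
  have Q: "w (Suc k) = Q_map (g (Suc k)) (\<eta>, snd (w k))"
    using next_halfline[OF k] \<eta> wk by metis
  show "vle (snd (w (Suc k))) (snd (w k))"
    unfolding Q by (rule new.Q_map_super_invariant(2)[OF sup])
  show "w (Suc k) \<noteq> w k"
  proof
    assume "w (Suc k) = w k"
    with inv' have "invariant_hl (g (Suc k)) (w k)" by simp
    then have "invariant_hl (minmap A fa) (w k)"
      using improvement[OF k] unfolding invariant_hl_def by eventually_elim simp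
    then show False using run k by (simp add: alg1_run_def)
  qed
  assume F: "rigid (bar_map (g (Suc k)) \<eta>) F"
  show "snd (w (Suc k)) $ i = snd (w k) $ i" if "i \<in> F"
    unfolding Q using new.Q_map_super_invariant(3)[OF sup F that] .
  \<comment> \<open>On \<open>F\<close>, super-invariance and rigidity make the new bar map fix the
    offset of \<open>w k\<close>. The minimum along \<open>w k\<close> thus equals the value of
    \<open>g k\<close>: the old action is still optimal and must be kept.\<close>
  have "sig (Suc k) i = sig k i" if i: "i \<in> F" for i
  proof (rule conservative[OF k])
    have fixed: "bar_map (g (Suc k)) \<eta> (snd (w k)) $ i = snd (w k) $ i"
      using F i new.super_invariant_imp[OF sup] by (simp add: rigid_def vle_def)
    have "\<forall>\<^sub>F t in at_top.
        g (Suc k) (hl (w k) t) = (t + 1) *\<^sub>R \<eta> + bar_map (g (Suc k)) \<eta> (snd (w k))"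
      using new.eventually_bar_map[of "snd (w k)"] by (simp add: hl_def \<eta>)
    then show "\<forall>\<^sub>F t in at_top. minmap A fa (hl (w k) t) $ i = g k (hl (w k) t) $ i"
      using improvement[OF k] inv unfolding invariant_hl_def
      by eventually_elim (simp add: fixed hl_def \<eta>)
  qed
  then have same: "g k x $ i = g (Suc k) x $ i" if "i \<in> F" for i x
    using that by (simp add: strat_map_def)
  have "bar_map (g k) \<eta> x $ i = bar_map (g (Suc k)) \<eta> x $ i" if "i \<in> F" for x i
    using new.eventually_bar_map[of x]
    by (intro old.bar_map_component_eqI) (auto elim!: eventually_mono simp: same[OF that])
  then show "rigid (bar_map (g k) \<eta>) F"
    using F rigid_cong by metis
qed

lemma strategy_not_repeated:
  assumes kl: "k < l" and l: "l \<le> N" shows "sig k \<noteq> sig l"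
proof
  assume eq: "sig k = sig l"
  define \<eta> where "\<eta> = fst (w k)"
  have "fst (w l) = \<eta>"
    unfolding \<eta>_def using slope_unique[OF topical_g[OF l] invariant_w[OF l]] invariant_w[of k] eq kl l
    by simp
  \<comment> \<open>The slopes decrease and agree at both ends, so they are constant on the
    block.\<close>
  then have \<eta>: "fst (w j) = \<eta>" if "k \<le> j" "j \<le> l" for j
    using slope_antimono[of k j] slope_antimono[of j l] that l
    by (intro vle_antisym) (simp_all add: \<eta>_def)
  let ?v = "\<lambda>j. snd (w j)" and ?h = "\<lambda>j. bar_map (g j) \<eta>"
  have mono: "vle (?v j) (?v i)" if "k \<le> i" "i \<le> j" "j \<le> l" for i j
    using that(2,3)
  proof (induction j rule: dec_induct)
    case base
    show ?case by (simp add: vle_def)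
  next
    case (step j)
    then show ?case
      using degenerate_step(1)[of j \<eta>] \<eta> that(1) l by (auto intro: vle_trans)
  qed
  have "?v l = ?v k"
  proof (rule ccontr)
    assume ne: "?v l \<noteq> ?v k"
    have k: "k \<le> N" and inv: "invariant_hl (g k) (w k)" "invariant_hl (g k) (w l)"
      using invariant_w[of k] invariant_w[of l] kl l eq by simp_all
    interpret polyhedral_topical "g k" \<eta>
      using polyhedral_topical_g k inv(1) by (simp add: \<eta>_def)
    \<comment> \<open>Because \<open>sig k = sig l\<close>, both offsets are fixed points of one and
      the same bar map.\<close>
    have fixed: "?h k (?v k) = ?v k" "?h k (?v l) = ?v l"
      using inv \<eta> kl invariant_iff by (metis order_refl less_imp_le prod.collapse)+
    obtain F i where F: "rigid (?h k) F" and i: "i \<in> F" "?v l $ i \<noteq> ?v k $ i"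
    proof (rule rigid_set_exists[OF topical_bar_map convex_bar_map[OF convex_g[OF k]] fixed(1)])
      show "vle (?h k (?v l)) (?v l)" by (simp add: fixed(2) vle_def)
      show "vle (?v l) (?v k)" using mono kl by simp
    qed (use ne in auto)
    \<comment> \<open>Backward induction: the base case \<open>j = l\<close> is rigid because its
      map is again \<open>g k\<close>.\<close>
    have rig: "rigid (?h j) F" if "k \<le> j" "j \<le> l" for j
      using that(2,1)
    proof (induction j rule: inc_induct)
      case base
      show ?case using F eq by simp
    next
      case (step j)
      then show ?case using degenerate_step(2)[of j \<eta> F] \<eta> l by simp
    qed
    have const: "?v j $ i = ?v k $ i" if "k \<le> j" "j \<le> l" for j
      using that
    proof (induction j rule: dec_induct)
      case (step j)
      then show ?case using degenerate_step(3)[of j \<eta> F i] \<eta> rig i(1) l by simp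
    qed simp
    show False using const[of l] i(2) kl by simp
  qed
  \<comment> \<open>The offset at \<open>Suc k\<close> is squeezed between the equal offsets at
    \<open>l\<close> and \<open>k\<close>.\<close>
  then have "?v (Suc k) = ?v k"
    using mono[of k "Suc k"] mono[of "Suc k" l] kl by (intro vle_antisym) simp_all
  then have "w (Suc k) = w k"
    using \<eta>[of k] \<eta>[of "Suc k"] kl by (simp add: prod_eq_iff)
  then show False
    using degenerate_step(4)[of k \<eta>] \<eta>[of k] \<eta>[of "Suc k"] kl l by simp
qed

end

theorem theorem4p4:
  fixes A :: "'n::finite \<Rightarrow> 'a set"
    and fa :: "'n \<Rightarrow> 'a \<Rightarrow> real^'n \<Rightarrow> real"
    and N :: nat and sig :: "nat \<Rightarrow> 'n \<Rightarrow> 'a" and w :: "nat \<Rightarrow> 'n halfline"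
  assumes fin: "\<And>i. finite (A i)" and ne: "\<And>i. A i \<noteq> {}"
    and poly: "\<And>i a. a \<in> A i \<Longrightarrow> polyhedral_fun (fa i a)"
    and op: "\<And>i a. a \<in> A i \<Longrightarrow> order_preserving_fun (fa i a)"
    and ah: "\<And>i a. a \<in> A i \<Longrightarrow> add_homogeneous_fun (fa i a)"
    and cvx: "\<And>i a. a \<in> A i \<Longrightarrow> convex_on UNIV (fa i a)"
    and run: "alg1_run A fa N sig w"
  shows "inj_on sig {..N} \<and> N < card (strategies A)"
proof -
  interpret policy_iteration A fa N sig w
    using assms by unfold_locales
  have inj: "inj_on sig {..N}"
    using strategy_not_repeated by (intro linorder_inj_onI) auto
  have "strategies A = PiE UNIV A"
    by (auto simp: strategies_def)
  then have "finite (strategies A)"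
    using fin by (simp add: finite_PiE)
  \<comment> \<open>The index set \<open>{..N}\<close> has \<open>N + 1\<close> elements, whence the
    strict bound.\<close>
  then have "card {..N} \<le> card (strategies A)"
    using strategy by (intro card_inj_on_le[OF inj]) auto
  with inj show ?thesis by simp
qed

end
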